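(* Let $\alpha\ge0$ be real, let $k\ge3$ be an integer, and let $0\le\beta<1$, $\mu\ge0$ and $\lambda\ge1$. Let $f(z)=z+\sum_{n=2}^{\infty}a_nz^n$ be in the class $H_{\Sigma}(\beta,\mu,\lambda)$ (defined in the context using the Cesàro mean of order $\alpha$). Then $$|a_2|\le\frac{\binom{k+\alpha-1}{k-2}}{\binom{k+\alpha-2}{k-2}}\sqrt{\frac{2(1-\beta)}{1+2\lambda}}$$ and $$|a_3|\le\frac{\binom{k+\alpha-1}{k-3}}{\binom{k+\alpha-3}{k-3}}\left[\frac{4(1-\beta)^2}{(1+\lambda)^2}+\frac{2(1-\beta)}{1+2\lambda}\right].$$
   Context: $U=\{z\in\mathbb{C}:|z|<1\}$. $A$ is the class of functions $f(z)=z+\sum_{n\ge2}a_nz^n$ analytic in $U$, and $S\subset A$ is the subclass of univalent functions. $\Sigma$ is the class of bi-univalent functions: those $f\in S$ for which the inverse $f^{-1}$ (defined near $0$) extends to a univalent analytic function $g$ on $U$; its expansion begins $g(w)=w-a_2w^2+(2a_2^2-a_3)w^3-\cdots$. Binomial coefficients with real upper entry and integer lower entry $m\ge 0$ are $\binom{x}{m}=\frac{x(x-1)\cdots(x-m+1)}{m!}$. For real $\alpha\ge0$ and integer $k$, the Cesàro mean of order $\alpha$ of a function $h(z)=z+\sum_{n\ge2}h_nz^n$ is $$\delta^{\alpha}h(z)=z+\sum_{n=2}^{\infty}A_nh_nz^n,\qquad A_n=\frac{\binom{k+\alpha-n}{k-n}}{\binom{k+\alpha-1}{k-n}}\ \ (2\le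 n\le k),\qquad A_n=0\ \ (n>k).$$ The class $H_{\Sigma}(\beta,\mu,\lambda)$ (with $0\le\beta<1$, $\lambda\ge1$; the parameter $\mu$ in the notation plays no role) consists of all $f\in\Sigma$ such that $$\Re\left\{\frac{(1-\lambda)\delta^{\alpha}f(z)+\lambda z(\delta^{\alpha}f)'(z)}{z}\right\}>\beta\quad(z\in U)$$ and $$\Re\left\{\frac{(1-\lambda)\delta^{\alpha}g(w)+\lambda w(\delta^{\alpha}g)'(w)}{w}\right\}>\beta\quad(w\in U),$$ where $g$ is the extension of $f^{-1}$ to $U$ and the quotients are given the value $1$ at the origin. *)

theory Defs
  imports "HOL-Complex_Analysis.Complex_Analysis"
begin

abbreviation unit_disc :: "complex set"  (\<open>\<U>\<close>)
  where "\<U> \<equiv> ball 0 1"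

text \<open>The sequence \<open>a\<close> only matters from index 2 on:
  \<open>f z = z + (\<Sum>n\<ge>2. a n * z ^ n)\<close> for all \<open>z\<close> in the disc.\<close>

definition normalized_series :: "(nat \<Rightarrow> complex) \<Rightarrow> (complex \<Rightarrow> complex) \<Rightarrow> bool"
  where "normalized_series a f \<longleftrightarrow>
    (\<forall>z\<in>\<U>. (\<lambda>n. a (n + 2) * z ^ (n + 2)) sums (f z - z))"

definition class_A :: "(complex \<Rightarrow> complex) set"
  where "class_A = {f. f analytic_on \<U> \<and> (\<exists>a. normalized_series a f)}"

definition class_S :: "(complex \<Rightarrow> complex) set"
  where "class_S = {f \<in> class_A. inj_on f \<U>}"

text \<open>For \<open>f\<close> in \<open>class_S\<close> the image of the disc is a neighbourhood of 0, so \<open>inv_into \<U> f\<close>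
  is the genuine inverse near 0.  By the identity theorem \<open>g\<close> is then determined on \<open>\<U>\<close>.\<close>

definition univalent_inverse_extension ::
    "(complex \<Rightarrow> complex) \<Rightarrow> (complex \<Rightarrow> complex) \<Rightarrow> bool"
  where "univalent_inverse_extension f g \<longleftrightarrow>
    g analytic_on \<U> \<and> inj_on g \<U> \<and> (\<forall>\<^sub>F w in nhds 0. g w = inv_into \<U> f w)"

definition class_Sigma :: "(complex \<Rightarrow> complex) set"
  where "class_Sigma = {f \<in> class_S. \<exists>g. univalent_inverse_extension f g}"

definition cesaro_coeff :: "real \<Rightarrow> nat \<Rightarrow> nat \<Rightarrow> real"
  where "cesaro_coeff \<alpha> k n =
    (if n \<le> k
     then ((real k + \<alpha> - real n) gchoose (k - n)) / ((real k + \<alpha> - 1) gchoose (k - n))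
     else 0)"

text \<open>The coefficients of \<open>h\<close> are those of its Taylor expansion at 0; the series has only
  finitely many nonzero terms.\<close>

definition cesaro_mean :: "real \<Rightarrow> nat \<Rightarrow> (complex \<Rightarrow> complex) \<Rightarrow> complex \<Rightarrow> complex"
  where "cesaro_mean \<alpha> k h z =
    z + (\<Sum>n. of_real (cesaro_coeff \<alpha> k (n + 2)) * fps_nth (fps_expansion h 0) (n + 2) * z ^ (n + 2))"

definition cesaro_quotient ::
    "real \<Rightarrow> nat \<Rightarrow> real \<Rightarrow> (complex \<Rightarrow> complex) \<Rightarrow> complex \<Rightarrow> complex"
  where "cesaro_quotient \<alpha> k l h z =
    (if z = 0 then 1
     else ((1 - of_real l) * cesaro_mean \<alpha> k h z + of_real l * z * deriv (cesaro_mean \<alpha> k h) z) / z)"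

text \<open>The parameter \<open>\<mu>\<close> is part of the traditional notation for this class but plays no role.\<close>

definition class_H ::
    "real \<Rightarrow> nat \<Rightarrow> real \<Rightarrow> real \<Rightarrow> real \<Rightarrow> (complex \<Rightarrow> complex) set"
  where "class_H \<alpha> k \<beta> \<mu> l =
    {f \<in> class_Sigma.
       (\<forall>z\<in>\<U>. Re (cesaro_quotient \<alpha> k l f z) > \<beta>) \<and>
       (\<exists>g. univalent_inverse_extension f g \<and>
            (\<forall>w\<in>\<U>. Re (cesaro_quotient \<alpha> k l g w) > \<beta>))}"

end

theory Submission imports Defs begin

text \<open>The quotients formed from \<open>f\<close> and \<open>g\<close> are polynomials with value 1 at the origin and real
  part above \<open>\<beta>\<close>, so by Caratheodory's inequality their coefficients of \<open>z\<^sup>2\<close> are at most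
  \<open>2 (1 - \<beta>)\<close> in modulus. Since \<open>g\<close> has third coefficient \<open>2 a\<^sub>2\<^sup>2 - a\<^sub>3\<close>, this bounds both
  \<open>a\<^sub>3\<close> and \<open>2 a\<^sub>2\<^sup>2 - a\<^sub>3\<close> by \<open>2 (1 - \<beta>) / ((1 + 2 \<lambda>) A\<^sub>3)\<close>; adding the two gives the same
  bound for \<open>a\<^sub>2\<^sup>2\<close>, and \<open>A\<^sub>2\<^sup>2 \<le> A\<^sub>3\<close> turns it into the stated one.\<close>

section \<open>Caratheodory's inequality for Taylor coefficients\<close>

text \<open>Along the circle \<open>du / u\<close> is \<open>2 * pi * \<i>\<close> times
  \<open>dx\<close>, so a Cauchy integral becomes an average over \<open>{0..1}\<close>, where the
  sign of an integrand can be used.\<close>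

lemma has_integral_circlepath_0:
  assumes "((\<lambda>u. h u / u) has_contour_integral 2 * pi * \<i> * I) (circlepath 0 r)" and "r > 0"
  shows "((\<lambda>x. h (circlepath 0 r x)) has_integral I) {0..1}"
proof -
  have nz: "circlepath 0 r x \<noteq> 0" for x
    using assms by (simp add: circlepath_def part_circlepath_def)
  have vd: "vector_derivative (circlepath 0 r) (at x) = 2 * pi * \<i> * circlepath 0 r x" for x
    by (simp add: circlepath_def vector_derivative_part_circlepath)
       (simp add: part_circlepath_def)
  have "((\<lambda>x. 2 * pi * \<i> * h (circlepath 0 r x)) has_integral 2 * pi * \<i> * I) {0..1}"
    using assms(1) nz unfolding has_contour_integral vd by (simp add: field_simps)
  from has_integral_mult_right[OF this, of "1 / (2 * pi * \<i>)"] show ?thesis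
    by simp
qed

text \<open>Integrate \<open>p\<close> over the circle of radius \<open>r\<close> against the nonnegative kernel
  \<open>2 + 2 Re (w (u / r)\<^sup>m)\<close>, where the unimodular \<open>w\<close> rotates the coefficient onto the negative
  real axis.\<close>
lemma caratheodory_nonneg_radius:
  assumes holo: "p holomorphic_on ball 0 1" and exp: "p has_fps_expansion P"
    and Re: "\<And>z. z \<in> ball 0 1 \<Longrightarrow> Re (p z) \<ge> 0" and m: "m > 0" and r: "0 < r" "r < 1"
  shows "norm (fps_nth P m) * r ^ m \<le> 2 * Re (p 0)"
proof -
  define c where "c = fps_nth P m"
  obtain w where w: "norm w = 1" "cnj w * c = - of_real (norm c)"
  proof (cases "c = 0")
    case False
    have "cnj (- sgn c) * c = - (of_real (norm c)^2 / of_real (norm c))"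
      using complex_norm_square[of c] by (simp add: sgn_eq mult_ac)
    then show ?thesis
      using that[of "- sgn c"] False by (simp add: power2_eq_square norm_sgn)
  qed (use that[of 1] in auto)
  have c: "c = (deriv ^^ m) p 0 / fact m" 
    unfolding c_def by (rule fps_nth_fps_expansion[OF exp])
  have cont: "continuous_on (cball 0 r) p" and hol: "p holomorphic_on ball 0 r"
    using r holo by (auto intro!: holomorphic_on_imp_continuous_on intro: holomorphic_on_subset)
  \<comment> \<open>Cauchy's formula for the three powers of \<open>u\<close> that make up the
    kernel: averaged against exponents 0, \<open>-m\<close> and \<open>m\<close>, \<open>p\<close>
    gives \<open>p 0\<close>, \<open>c\<close> and, as \<open>u ^ m\<close> vanishes at 0,
    zero.\<close>
  have 0: "((\<lambda>u. p u / u) has_contour_integral 2 * pi * \<i> * p 0) (circlepath 0 r)"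
    using Cauchy_has_contour_integral_higher_derivative_circlepath[OF cont hol, of 0 0] r by simp
  have 1: "((\<lambda>u. p u / u ^ Suc m) has_contour_integral 2 * pi * \<i> * c) (circlepath 0 r)"
    using Cauchy_has_contour_integral_higher_derivative_circlepath[OF cont hol, of 0 m] r
    by (simp add: c)
  have 2: "((\<lambda>u. p u * u ^ m / u) has_contour_integral 2 * pi * \<i> * 0) (circlepath 0 r)"
  proof -
    have "continuous_on (cball 0 r) (\<lambda>u. p u * u ^ m)" "(\<lambda>u. p u * u ^ m) holomorphic_on ball 0 r"
      by (intro continuous_intros holomorphic_intros cont hol)+
    from Cauchy_has_contour_integral_higher_derivative_circlepath[OF this, of 0 0] show ?thesis
      using r m by (simp add: zero_power)
  qed
  define k where "k = (\<lambda>u::complex. 2 + 2 * Re (w * (u / r) ^ m))"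
  have k_nonneg: "k u \<ge> 0" if "norm u = r" for u
    using abs_Re_le_cmod[of "w * (u / r) ^ m"] w r that
    by (simp add: k_def norm_mult norm_power norm_divide)
  have "((\<lambda>u. 2 * (p u / u) + w / r ^ m * (p u * u ^ m / u) + cnj w * r ^ m * (p u / u ^ Suc m))
      has_contour_integral 2 * (2 * pi * \<i> * p 0) + w / r ^ m * (2 * pi * \<i> * 0)
        + cnj w * r ^ m * (2 * pi * \<i> * c)) (circlepath 0 r)"
    by (intro has_contour_integral_add has_contour_integral_lmul 0 1 2)
  also have "2 * (2 * pi * \<i> * p 0) + w / r ^ m * (2 * pi * \<i> * 0) + cnj w * r ^ m * (2 * pi * \<i> * c)
      = 2 * pi * \<i> * (2 * p 0 + (cnj w * c) * r ^ m)"
    by (simp add: algebra_simps)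
  finally have "((\<lambda>u. p u * k u / u) has_contour_integral
      2 * pi * \<i> * (2 * p 0 + (cnj w * c) * r ^ m)) (circlepath 0 r)"
  proof (rule has_contour_integral_eq)
    fix u assume "u \<in> path_image (circlepath 0 r)"
    then have u: "norm u = r" "u \<noteq> 0"
      using r by auto
    \<comment> \<open>On the circle, conjugating \<open>u / r\<close> inverts it, which turns the
      real kernel into the Laurent polynomial just integrated.\<close>
    have cu: "cnj (u / r) = r / u"
      using u r complex_norm_square[of u] by (simp add: field_simps power2_eq_square)
    have "complex_of_real (k u) = 2 + (w * (u / r) ^ m + cnj (w * (u / r) ^ m))"
      unfolding complex_add_cnj k_def by simp
    also have "cnj (w * (u / r) ^ m) = cnj w * (r / u) ^ m"
      using cu by simp
    finally show "2 * (p u / u) + w / r ^ m * (p u * u ^ m / u) + cnj w * r ^ m * (p u / u ^ Suc m)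
        = p u * k u / u"
      using u r by (simp add: power_divide field_simps)
  qed
  then have "((\<lambda>x. p (circlepath 0 r x) * k (circlepath 0 r x)) has_integral
      2 * p 0 + (cnj w * c) * r ^ m) {0..1}"
    using r(1) by (rule has_integral_circlepath_0)
  from has_integral_Re[OF this]
  have "((\<lambda>x. Re (p (circlepath 0 r x)) * k (circlepath 0 r x)) has_integral
      2 * Re (p 0) - norm c * r ^ m) {0..1}"
    unfolding w(2) by simp
  then have "0 \<le> 2 * Re (p 0) - norm c * r ^ m"
  proof (rule has_integral_nonneg)
    fix x :: real assume "x \<in> {0..1}"
    have "norm (circlepath 0 r x) = r"
      using r by (simp add: circlepath_def part_circlepath_def norm_mult)
    then show "0 \<le> Re (p (circlepath 0 r x)) * k (circlepath 0 r x)"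
      using r by (intro mult_nonneg_nonneg Re k_nonneg) auto
  qed
  then show ?thesis
    by (simp add: c_def)
qed

text \<open>Subtracting \<open>\<beta>\<close> alters only the constant coefficient, so the case of
  nonnegative real part applies for each radius \<open>r < 1\<close>; letting \<open>r\<close> tend
  to 1 removes the factor \<open>r ^ m\<close>.\<close>

lemma caratheodory_coeff_bound:
  assumes holo: "p holomorphic_on ball 0 1" and exp: "p has_fps_expansion P"
    and Re: "\<And>z. z \<in> ball 0 1 \<Longrightarrow> Re (p z) \<ge> \<beta>" and m: "m > 0"
  shows "norm (fps_nth P m) \<le> 2 * (Re (p 0) - \<beta>)"
proof (rule tendsto_upperbound)
  have exp': "(\<lambda>z. p z - of_real \<beta>) has_fps_expansion P - fps_const (of_real \<beta>)"
    by (intro fps_expansion_intros exp)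
  have "norm (fps_nth P m) * r ^ m \<le> 2 * (Re (p 0) - \<beta>)" if "0 < r" "r < 1" for r
  proof -
    have "(\<lambda>z. p z - of_real \<beta>) holomorphic_on \<U>"
      by (intro holomorphic_intros holo)
    from caratheodory_nonneg_radius[OF this exp' _ m that] show ?thesis
      using Re m by simp
  qed
  then show "\<forall>\<^sub>F r in at_left 1. norm (fps_nth P m) * r ^ m \<le> 2 * (Re (p 0) - \<beta>)"
    using eventually_at_left_real[of 0 1] by (auto elim!: eventually_mono)
  show "((\<lambda>r. norm (fps_nth P m) * r ^ m) \<longlongrightarrow> norm (fps_nth P m)) (at_left 1)"
    by (auto intro!: tendsto_eq_intros)
qed auto

section \<open>Power series of the function and of its inverse\<close>

lemma normalized_series_has_fps_expansion:
  assumes "normalized_series a f"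
  shows "f has_fps_expansion Abs_fps (\<lambda>n. if n < 2 then of_nat n else a n)"
    (is "f has_fps_expansion ?F")
proof (rule has_fps_expansionI)
  have "(\<lambda>n. fps_nth ?F n * z ^ n) sums f z" if "z \<in> \<U>" for z
  proof -
    have "(\<lambda>n. fps_nth ?F (n + 2) * z ^ (n + 2)) sums (f z - z)"
      using assms that by (simp add: normalized_series_def)
    then show ?thesis
      by (subst (asm) sums_iff_shift) (simp add: numeral_2_eq_2)
  qed
  then show "\<forall>\<^sub>F u in nhds 0. (\<lambda>n. fps_nth ?F n * u ^ n) sums f u"
    by (intro eventually_nhds_in_open[THEN eventually_mono, of \<U>]) auto
qed

text \<open>By uniqueness of expansions \<open>G oo F\<close> is \<open>fps_X\<close>; comparing
  coefficients 1 to 3 gives a triangular system for those of \<open>G\<close>.\<close>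

lemma inverse_fps_coeffs:
  fixes f g :: "complex \<Rightarrow> complex"
  assumes f: "f has_fps_expansion F" and g: "g has_fps_expansion G"
    and F0: "fps_nth F 0 = 0" and F1: "fps_nth F 1 = 1"
    and gf: "\<forall>\<^sub>F z in nhds 0. g (f z) = z"
  shows "fps_nth G 2 = - fps_nth F 2" and "fps_nth G 3 = 2 * (fps_nth F 2)\<^sup>2 - fps_nth F 3"
proof -
  have "(g \<circ> f) has_fps_expansion (G oo F)"
    by (intro has_fps_expansion_compose f g F0)
  moreover have "(g \<circ> f) has_fps_expansion fps_X"
    using has_fps_expansion_fps_X gf
    by (subst has_fps_expansion_cong) auto
  ultimately have GF: "G oo F = fps_X"
    by (metis fps_expansion_unique_complex)
  have nth: "fps_nth (G oo F) n = fps_nth fps_X n" for n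
    by (simp add: GF)
  have "fps_nth G 1 = 1"
    using nth[of 1] F0 F1 by (simp add: fps_compose_nth)
  moreover have "fps_nth G 1 * fps_nth F 2 + fps_nth G 2 = 0"
    using nth[of 2] F0 F1 by (simp add: fps_compose_nth numeral_2_eq_2 fps_mult_nth)
  moreover have "fps_nth G 1 * fps_nth F 3 + 2 * fps_nth G 2 * fps_nth F 2 + fps_nth G 3 = 0"
    using nth[of 3] F0 F1 by (simp add: fps_compose_nth numeral_2_eq_2 numeral_3_eq_3 fps_mult_nth mult_ac)
  ultimately show "fps_nth G 2 = - fps_nth F 2" "fps_nth G 3 = 2 * (fps_nth F 2)\<^sup>2 - fps_nth F 3"
    by (algebra)+
qed

section \<open>Closed forms of the Cesaro coefficients\<close>

lemma cesaro_coeff_2: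
  assumes "\<alpha> \<ge> 0" "k \<ge> 2"
  shows "cesaro_coeff \<alpha> k 2 = (\<alpha> + 1) / (real k + \<alpha> - 1)"
proof -
  let ?a = "real k + \<alpha> - 1"
  \<comment> \<open>Absorption moves the upper entry from \<open>?a\<close> to
    \<open>?a - 1\<close>; its factor \<open>?a - (k - 2)\<close> is
    \<open>\<alpha> + 1\<close>.\<close>
  have "(\<alpha> + 1) * (?a gchoose (k - 2)) = ?a * ((?a - 1) gchoose (k - 2))"
    using gbinomial_absorb_comp[of ?a "k - 2"] assms by (simp add: of_nat_diff)
  moreover have "?a gchoose (k - 2) > 0"
    unfolding gbinomial_pochhammer' using assms by (intro divide_pos_pos pochhammer_pos) auto
  ultimately show ?thesis
    using assms by (simp add: cesaro_coeff_def field_simps)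
qed

text \<open>Absorption applied twice lowers the upper entry from \<open>k + \<alpha> - 1\<close> to
  \<open>k + \<alpha> - 3\<close>, each use contributing one factor of the quotient.\<close>

lemma cesaro_coeff_3:
  assumes "\<alpha> \<ge> 0" "k \<ge> 3"
  shows "cesaro_coeff \<alpha> k 3 = (\<alpha> + 1) * (\<alpha> + 2) / ((real k + \<alpha> - 1) * (real k + \<alpha> - 2))"
proof -
  let ?a = "real k + \<alpha> - 1"
  have 1: "(\<alpha> + 2) * (?a gchoose (k - 3)) = ?a * ((?a - 1) gchoose (k - 3))"
    using gbinomial_absorb_comp[of ?a "k - 3"] assms by (simp add: of_nat_diff)
  have 2: "(\<alpha> + 1) * ((?a - 1) gchoose (k - 3)) = (?a - 1) * ((?a - 2) gchoose (k - 3))"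
    using gbinomial_absorb_comp[of "?a - 1" "k - 3"] assms by (simp add: of_nat_diff)
  have 3: "?a gchoose (k - 3) > 0"
    unfolding gbinomial_pochhammer' using assms by (intro divide_pos_pos pochhammer_pos) auto
  have "(\<alpha> + 1) * (\<alpha> + 2) * (?a gchoose (k - 3)) = ?a * (?a - 1) * ((?a - 2) gchoose (k - 3))"
    using 1 2 by algebra
  then have "((?a - 2) gchoose (k - 3)) / (?a gchoose (k - 3)) = (\<alpha> + 1) * (\<alpha> + 2) / (?a * (?a - 1))"
    using 3 assms by (subst frac_eq_eq) (auto simp: mult_ac)
  then show ?thesis
    using assms by (simp add: cesaro_coeff_def)
qed

section \<open>Cesaro quotients as polynomials\<close>

text \<open>The Cesaro coefficients vanish beyond \<open>k\<close>, so the mean is a polynomial.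
  Combining it with its derivative multiplies the term of degree \<open>n\<close> by
  \<open>1 + (n - 1) * l\<close>, and dividing by \<open>z\<close> moves degree 3 to degree
  2.\<close>

lemma cesaro_quotient_poly:
  obtains q where "\<And>z. cesaro_quotient \<alpha> k l h z = poly q z" "poly q 0 = 1"
    "coeff q 2 = (1 + 2 * of_real l) * of_real (cesaro_coeff \<alpha> k 3) * fps_nth (fps_expansion h 0) 3"
proof -
  define b where "b = (\<lambda>n. of_real (cesaro_coeff \<alpha> k n) * fps_nth (fps_expansion h 0) n)"
  have b0: "b n = 0" if "n > k" for n
    using that by (simp add: b_def cesaro_coeff_def)
  \<comment> \<open>Terms with \<open>n + 2 > k\<close> are zero; the bound \<open>k + 2\<close>
    keeps \<open>n = 1\<close>, the source of \<open>coeff q 2\<close>, in range for every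
    \<open>k\<close>.\<close>
  define C where "C = [:0, 1:] + (\<Sum>n<k+2. monom (b (n + 2)) (n + 2))"
  define q where "q = 1 + (\<Sum>n<k+2. monom ((1 + of_nat (n + 1) * of_real l) * b (n + 2)) (n + 1))"
  have C: "cesaro_mean \<alpha> k h = poly C"
  proof
    fix z
    have "(\<Sum>n. b (n + 2) * z ^ (n + 2)) = (\<Sum>n<k+2. b (n + 2) * z ^ (n + 2))"
      by (rule suminf_finite) (auto simp: b0)
    then show "cesaro_mean \<alpha> k h z = poly C z"
      by (simp add: cesaro_mean_def C_def b_def poly_sum poly_monom)
  qed
  have "cesaro_quotient \<alpha> k l h z = poly q z" for z
  proof (cases "z = 0")
    case False
    have dC: "z * poly (pderiv C) z = z + (\<Sum>n<k+2. of_nat (n + 2) * b (n + 2) * z ^ (n + 2))"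
      by (simp add: C_def pderiv_add higher_pderiv_sum[of 1, simplified] pderiv_monom
          pderiv_pCons poly_sum poly_monom sum_distrib_left algebra_simps)
    have "z * poly q z = z + (\<Sum>n<k+2. (1 + of_nat (n + 1) * of_real l) * b (n + 2) * z ^ (n + 2))"
      by (simp add: q_def poly_sum poly_monom sum_distrib_left algebra_simps)
    also have "\<dots> = (1 - of_real l) * poly C z + of_real l * (z * poly (pderiv C) z)"
      unfolding dC
      by (simp add: C_def poly_sum poly_monom sum_distrib_left algebra_simps
          sum.distrib sum_subtractf)
    finally show ?thesis
      using False by (simp add: cesaro_quotient_def C poly_DERIV[THEN DERIV_imp_deriv] field_simps)
  qed (simp add: cesaro_quotient_def q_def poly_sum poly_monom)
  moreover have "poly q 0 = 1"
    by (simp add: q_def poly_sum poly_monom)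
  moreover have "coeff q 2 = (1 + 2 * of_real l) * b 3"
  proof -
    have "coeff q 2 = (\<Sum>n<k+2. if n = 1 then (1 + 2 * of_real l) * b 3 else 0)"
      unfolding q_def coeff_add coeff_sum
      by (auto simp: coeff_1 numeral_2_eq_2 numeral_3_eq_3 intro!: sum.cong)
    then show ?thesis by simp
  qed
  ultimately show thesis
    using that[of q] by (simp add: b_def mult_ac)
qed

text \<open>Caratheodory's inequality with \<open>m = 2\<close> for the quotient polynomial, whose
  value at 0 is 1. It serves for \<open>f\<close> and for \<open>g\<close> alike.\<close>

lemma third_coeff_bound:
  assumes "\<alpha> \<ge> 0" "k \<ge> 3" "l \<ge> 0" and "h has_fps_expansion H"
    and "\<And>z. z \<in> \<U> \<Longrightarrow> Re (cesaro_quotient \<alpha> k l h z) \<ge> \<beta>"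
  shows "norm (fps_nth H 3) \<le> 2 * (1 - \<beta>) / (1 + 2 * l) / cesaro_coeff \<alpha> k 3"
proof -
  have H: "H = fps_expansion h 0"
    using assms(4) fps_expansion_unique_complex
    by (metis analytic_at_imp_has_fps_expansion_0 has_fps_expansion_imp_analytic_0)
  obtain q where q: "\<And>z. cesaro_quotient \<alpha> k l h z = poly q z" "poly q 0 = 1"
    "coeff q 2 = (1 + 2 * of_real l) * of_real (cesaro_coeff \<alpha> k 3) * fps_nth H 3"
    using cesaro_quotient_poly unfolding H by metis
  have pos: "cesaro_coeff \<alpha> k 3 > 0"
    using assms by (simp add: cesaro_coeff_3)
  have "norm (fps_nth (fps_of_poly q) 2) \<le> 2 * (Re (poly q 0) - \<beta>)"
  proof (rule caratheodory_coeff_bound)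
    show "poly q has_fps_expansion fps_of_poly q"
      by (simp add: has_fps_expansion_def)
  qed (use assms q in \<open>auto intro!: holomorphic_intros\<close>)
  moreover have "norm (1 + 2 * complex_of_real l) = 1 + 2 * l"
    using norm_of_real[of "1 + 2 * l", where 'a = complex] assms by simp
  ultimately have "(1 + 2 * l) * cesaro_coeff \<alpha> k 3 * norm (fps_nth H 3) \<le> 2 * (1 - \<beta>)"
    using q pos by (simp add: norm_mult)
  then show ?thesis
    using pos assms(3) by (simp add: pos_le_divide_eq mult_ac)
qed

section \<open>Coefficient estimates for \<open>class_H\<close>\<close>

theorem theorem4p2:
  fixes \<alpha> \<beta> \<mu> l :: real and k :: nat
    and f :: "complex \<Rightarrow> complex" and a :: "nat \<Rightarrow> complex"
  assumes "\<alpha> \<ge> 0" and "k \<ge> 3" and "0 \<le> \<beta>" and "\<beta> < 1" and "\<mu> \<ge> 0" and "l \<ge> 1"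
    and "f \<in> class_H \<alpha> k \<beta> \<mu> l"
    and "normalized_series a f"
  shows "norm (a 2) \<le>
           ((real k + \<alpha> - 1) gchoose (k - 2)) / ((real k + \<alpha> - 2) gchoose (k - 2))
             * sqrt (2 * (1 - \<beta>) / (1 + 2 * l))
       \<and> norm (a 3) \<le>
           ((real k + \<alpha> - 1) gchoose (k - 3)) / ((real k + \<alpha> - 3) gchoose (k - 3))
             * (4 * (1 - \<beta>)\<^sup>2 / (1 + l)\<^sup>2 + 2 * (1 - \<beta>) / (1 + 2 * l))"
proof -
  \<comment> \<open>The binomial quotients in the claim are \<open>1 / A2\<close> and
    \<open>1 / A3\<close>.\<close>
  define A2 A3 B where "A2 = cesaro_coeff \<alpha> k 2" and "A3 = cesaro_coeff \<alpha> k 3"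
    and "B = 2 * (1 - \<beta>) / (1 + 2 * l)"
  have B: "B \<ge> 0"
    using assms by (simp add: B_def)
  have pos: "A2 > 0" "A3 > 0"
    using assms by (simp_all add: A2_def A3_def cesaro_coeff_2 cesaro_coeff_3)
  have A23: "A2\<^sup>2 \<le> A3"
  proof -
    let ?x = "real k + \<alpha> - 1"
    \<comment> \<open>Beside the common factor \<open>(\<alpha> + 1) / ?x\<close>, the right side
      has the larger numerator and the smaller positive denominator.\<close>
    have "(\<alpha> + 1) / ?x * ((\<alpha> + 1) / ?x) \<le> (\<alpha> + 1) / ?x * ((\<alpha> + 2) / (?x - 1))"
      using assms by (intro mult_left_mono frac_le divide_nonneg_nonneg) auto
    then show ?thesis
      using assms by (simp add: A2_def A3_def cesaro_coeff_2 cesaro_coeff_3 power2_eq_square)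
  qed
  have inj: "inj_on f \<U>" and Ref: "\<And>z. z \<in> \<U> \<Longrightarrow> Re (cesaro_quotient \<alpha> k l f z) > \<beta>"
    using assms by (auto simp: class_H_def class_Sigma_def class_S_def)
  obtain g where g: "g analytic_on \<U>" "\<forall>\<^sub>F w in nhds 0. g w = inv_into \<U> f w"
    and Reg: "\<And>w. w \<in> \<U> \<Longrightarrow> Re (cesaro_quotient \<alpha> k l g w) > \<beta>"
    using assms by (auto simp: class_H_def univalent_inverse_extension_def)
  define F G where "F = Abs_fps (\<lambda>n. if n < 2 then of_nat n else a n)" and "G = fps_expansion g 0"
  have F: "f has_fps_expansion F"
    using normalized_series_has_fps_expansion[OF assms(8)] by (simp add: F_def)
  have G: "g has_fps_expansion G"
    unfolding G_def using g(1)
    by (intro analytic_at_imp_has_fps_expansion_0) (auto elim: analytic_on_subset)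
  have "f 0 = 0"
    using has_fps_expansion_imp_0_eq_fps_nth_0[OF F] by (simp add: F_def)
  \<comment> \<open>\<open>g\<close> agrees with the inverse of \<open>f\<close> only near 0;
    continuity and \<open>f 0 = 0\<close> carry this to \<open>g (f z)\<close> for small
    \<open>z\<close>, where injectivity gives \<open>z\<close> back.\<close>
  then have "filterlim f (nhds 0) (nhds 0)"
    using has_fps_expansion_imp_continuous[OF F, of UNIV] tendsto_at_iff_tendsto_nhds[of f 0]
    by (simp add: continuous_within)
  then have "\<forall>\<^sub>F z in nhds 0. g (f z) = inv_into \<U> f (f z)"
    using g(2) by (rule eventually_compose_filterlim[rotated])
  moreover have "\<forall>\<^sub>F z in nhds 0. z \<in> \<U>"
    by (intro eventually_nhds_in_open) auto
  ultimately have gf: "\<forall>\<^sub>F z in nhds 0. g (f z) = z"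
    by eventually_elim (simp add: inj)
  have G3: "fps_nth G 3 = 2 * (a 2)\<^sup>2 - a 3"
    using inverse_fps_coeffs(2)[OF F G _ _ gf] by (simp add: F_def)
  have a3: "norm (a 3) \<le> B / A3"
    using third_coeff_bound[OF _ _ _ F, of \<alpha> k l \<beta>] assms(1,2,6) Ref
    by (force simp: F_def B_def A3_def less_imp_le)
  have b3: "norm (2 * (a 2)\<^sup>2 - a 3) \<le> B / A3"
    using third_coeff_bound[OF _ _ _ G, of \<alpha> k l \<beta>] assms(1,2,6) Reg
    by (force simp: G3 B_def A3_def less_imp_le)
  have "norm (2 * (a 2)\<^sup>2) \<le> 2 * (B / A3)"
    using norm_triangle_ineq[of "2 * (a 2)\<^sup>2 - a 3" "a 3"] a3 b3 by simp
  then have "(norm (a 2))\<^sup>2 \<le> B / A3"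
    by (simp add: norm_mult norm_power)
  also have "\<dots> \<le> B / A2\<^sup>2"
    using A23 B pos by (intro divide_left_mono) auto
  finally have "norm (a 2) \<le> sqrt (B / A2\<^sup>2)"
    by (rule real_le_rsqrt)
  then have "norm (a 2) \<le> 1 / A2 * sqrt B"
    using pos by (simp add: real_sqrt_divide)
  moreover have "norm (a 3) \<le> 1 / A3 * (4 * (1 - \<beta>)\<^sup>2 / (1 + l)\<^sup>2 + B)"
  proof -
    \<comment> \<open>The other summand is a quotient of squares, hence nonnegative, so
      \<open>B / A3\<close> lies below the claimed bound.\<close>
    have "1 / A3 * B \<le> 1 / A3 * (4 * (1 - \<beta>)\<^sup>2 / (1 + l)\<^sup>2 + B)"
      using pos by (intro mult_left_mono) auto
    with a3 show ?thesis by simp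
  qed
  ultimately show ?thesis
    using assms(2) by (simp add: A2_def A3_def B_def cesaro_coeff_def)
qed

end
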